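(* Let $\Omega$ be an infinite set and let $f : A_f \to B_f$ and $g : A_g \to B_g$ be partial-bijections of $\Omega$. If $f$ and $g$ are almost equal, then $\operatorname{ind}(f) = \operatorname{ind}(g)$.
   Context: Let $\Omega$ be an infinite set. For $C \subseteq \Omega$ write $C' = \Omega \setminus C$ and $|C|$ for its cardinality. A partial-bijection of $\Omega$ is a bijection $f : A_f \to B_f$ where $A_f, B_f \subseteq \Omega$ are cofinite subsets. The index of $f$ is $\operatorname{ind}(f) = |A_f'| - |B_f'| \in \mathbb{Z}$. Two partial-bijections $f$ and $g$ are almost equal precisely when there is a cofinite subset of $\Omega$ contained in $A_f \cap A_g$ on which $f$ and $g$ agree. *)

theory Defs
  imports Main
begin

definition cofinite_in :: "'a set \<Rightarrow> 'a set \<Rightarrow> bool" where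
  "cofinite_in \<Omega> C \<longleftrightarrow> C \<subseteq> \<Omega> \<and> finite (\<Omega> - C)"

text \<open>A partial function is a map of type \<open>'a \<rightharpoonup> 'a\<close>, so that the domain and codomain of
  \<open>f : A \<rightarrow> B\<close> are part of \<open>f\<close>: \<open>A = dom f\<close> and \<open>B = ran f\<close>.\<close>

definition partial_bijection :: "'a set \<Rightarrow> ('a \<rightharpoonup> 'a) \<Rightarrow> bool" where
  "partial_bijection \<Omega> f \<longleftrightarrow>
     cofinite_in \<Omega> (dom f) \<and> cofinite_in \<Omega> (ran f) \<and> bij_betw (the \<circ> f) (dom f) (ran f)"

text \<open>For a partial bijection both complements are finite, so \<open>card\<close> is their true cardinality.\<close>

definition ind :: "'a set \<Rightarrow> ('a \<rightharpoonup> 'a) \<Rightarrow> int" where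
  "ind \<Omega> f = int (card (\<Omega> - dom f)) - int (card (\<Omega> - ran f))"

definition almost_equal :: "'a set \<Rightarrow> ('a \<rightharpoonup> 'a) \<Rightarrow> ('a \<rightharpoonup> 'a) \<Rightarrow> bool" where
  "almost_equal \<Omega> f g \<longleftrightarrow>
     (\<exists>C. cofinite_in \<Omega> C \<and> C \<subseteq> dom f \<inter> dom g \<and> (\<forall>x\<in>C. f x = g x))"

end

theory Submission
  imports Defs
begin

text \<open>The index can be computed from any cofinite \<open>C \<subseteq> dom f\<close>: restricting \<open>f\<close> to \<open>C\<close> enlarges both
  complements by the same finite number \<open>card (dom f - C)\<close> of points.\<close>

lemma ind_eq_restrict:
  assumes f: "partial_bijection \<Omega> f" and C: "cofinite_in \<Omega> C" "C \<subseteq> dom f"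
  shows "ind \<Omega> f = int (card (\<Omega> - C)) - int (card (\<Omega> - (the \<circ> f) ` C))"
proof -
  let ?h = "the \<circ> f"
  have inj: "inj_on ?h (dom f)" and img: "?h ` dom f = ran f"
    and dom: "dom f \<subseteq> \<Omega>" and ran: "ran f \<subseteq> \<Omega>" and fin_ran: "finite (\<Omega> - ran f)"
    using f by (auto simp: partial_bijection_def cofinite_in_def bij_betw_def)
  have fin_C: "finite (\<Omega> - C)"
    using C by (simp add: cofinite_in_def)
  \<comment> \<open>Both sets lie inside \<open>\<Omega> - C\<close>. Finiteness is what makes
    \<open>card\<close> additive on the disjoint unions below.\<close>
  have fin: "finite (\<Omega> - dom f)" "finite (dom f - C)"
    using fin_C C(2) dom by (auto intro: finite_subset [of _ "\<Omega> - C"])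
  \<comment> \<open>By injectivity, the points of \<open>ran f\<close> lost by restricting to
    \<open>C\<close> are exactly the images of the points lost from \<open>dom f\<close>.\<close>
  have diff: "?h ` (dom f - C) = ran f - ?h ` C"
    using inj_on_image_set_diff [OF inj _ C(2), of "dom f"] img by auto
  have "card (\<Omega> - C) = card ((\<Omega> - dom f) \<union> (dom f - C))"
    using C(2) dom by (intro arg_cong [where f = card]) blast
  also have "\<dots> = card (\<Omega> - dom f) + card (dom f - C)"
    using fin by (intro card_Un_disjoint) auto
  finally have card_dom: "card (\<Omega> - C) = card (\<Omega> - dom f) + card (dom f - C)" .
  have "?h ` C \<subseteq> ran f"
    using img C(2) by blast
  then have "card (\<Omega> - ?h ` C) = card ((\<Omega> - ran f) \<union> ?h ` (dom f - C))"
    unfolding diff using ran by (intro arg_cong [where f = card]) blast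
  also have "\<dots> = card (\<Omega> - ran f) + card (?h ` (dom f - C))"
    using fin_ran finite_imageI [OF fin(2)] img by (intro card_Un_disjoint) blast+
  \<comment> \<open>Injectivity again: domain and range lose equally many points, so this term
    cancels in the difference of the two complements.\<close>
  also have "card (?h ` (dom f - C)) = card (dom f - C)"
    using inj by (intro card_image) (auto intro: inj_on_subset)
  finally show ?thesis
    using card_dom by (simp add: ind_def)
qed

theorem theorem2:
  fixes \<Omega> :: "'a set" and f g :: "'a \<rightharpoonup> 'a"
  assumes "infinite \<Omega>"
    and "partial_bijection \<Omega> f"
    and "partial_bijection \<Omega> g"
    and "almost_equal \<Omega> f g"
  shows "ind \<Omega> f = ind \<Omega> g"
proof -
  obtain C where C: "cofinite_in \<Omega> C" "C \<subseteq> dom f" "C \<subseteq> dom g" "\<forall>x\<in>C. f x = g x"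
    using assms(4) by (auto simp: almost_equal_def)
  then have "(the \<circ> f) ` C = (the \<circ> g) ` C"
    by (intro image_cong) auto
  \<comment> \<open>One \<open>C\<close> serves both maps, and the formula in
    \<open>ind_eq_restrict\<close> depends on the map only through its image of \<open>C\<close>,
    which is now the same for \<open>f\<close> and \<open>g\<close>.\<close>
  then show ?thesis
    using ind_eq_restrict [OF assms(2) C(1,2)] ind_eq_restrict [OF assms(3) C(1,3)] by simp
qed

end
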